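(* Let $R$ be a semihyperring. The following conditions are equivalent: (1) $R$ is fully idempotent; (2) the set $FI_R$ of all fuzzy hyperideals of $R$, ordered by $\leq$, forms a distributive lattice under the sum $\oplus$ (as join) and the intersection $\wedge$ (as meet) of fuzzy hyperideals, and $\lambda\wedge\mu=\lambda\mu$ for each pair of fuzzy hyperideals $\lambda,\mu$ of $R$.
   Context: A commutative semihypergroup is a non-empty set $R$ with a map $\oplus$ from $R\times R$ to the non-empty subsets of $R$ which is commutative and associative, where $A\oplus B=\bigcup_{a\in A,b\in B}a\oplus b$ for subsets and an element is identified with its singleton when convenient. A semihyperring $(R,\oplus,\cdot)$ is a non-empty set $R$ such that $(R,\oplus)$ is a commutative semihypergroup, $(R,\cdot)$ is a semigroup, $x(y\oplus z)=xy\oplus xz$ and $(x\oplus y)z=xz\oplus yz$ for all $x,y,z\in R$ (equality of sets), and there is an element $0\in R$ with $0\oplus x=x\oplus 0=\{x\}$ and $0x=x0=0$ for all $x\in R$. No multiplicative identity is assumed. A hyperideal of $R$ is a non-empty subset $I\subseteq R$ with $x\oplus y\subseteq I$ for $x,y\in I$ and $rx,xr\in I$ for $r\in R$, $x\in I$. For hyperideals $I,J$, the product $IJ$ is the set of all elements lying in some finite hypersum $a_1b_1\oplus\cdots\oplus a_pb_p$ with $a_i\in I$, $b_i\in J$, $p\ge 1$. $R$ is fully idempotent if $I^2=I$ for every hyperideal $I$ of $R$. A fuzzy subset of $R$ is a function $\mu:R\to[0,1]$. $\lambda\leq\mu$ means $\lambda(x)\leq\mu(x)$ for all $x$. $\wedge$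 and $\vee$ denote (pointwise) infimum and supremum; the supremum of the empty set is $0$. A fuzzy hyperideal of $R$ is a fuzzy subset $\mu$ with $\mu(0)=1$, $\inf_{z\in x\oplus y}\mu(z)\geq\mu(x)\wedge\mu(y)$, $\mu(xy)\geq\mu(x)$ and $\mu(yx)\geq\mu(x)$ for all $x,y\in R$. For fuzzy hyperideals $\lambda,\mu$, the sum and product are the fuzzy subsets $$(\lambda\oplus\mu)(x)=\bigvee_{x\in y\oplus z}[\lambda(y)\wedge\mu(z)],\qquad (\lambda\mu)(x)=\bigvee_{x\in y_1z_1\oplus\cdots\oplus y_pz_p}\ \bigwedge_{1\le i\le p}[\lambda(y_i)\wedge\mu(z_i)],$$ the second supremum being over all $p\ge 1$ and all $y_i,z_i\in R$ with $x\in y_1z_1\oplus\cdots\oplus y_pz_p$. *)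

theory Defs
  imports Complex_Main "HOL-Library.FuncSet" "HOL-Algebra.Lattice"
begin

record 'a semihyperring = "'a partial_object" +
  hadd :: "'a \<Rightarrow> 'a \<Rightarrow> 'a set"  (infixl "\<oplus>\<index>" 65)
  hmult :: "'a \<Rightarrow> 'a \<Rightarrow> 'a"  (infixl "\<otimes>\<index>" 70)
  hzero :: 'a  ("\<zero>\<index>")

definition set_hadd :: "('a, 'c) semihyperring_scheme \<Rightarrow> 'a set \<Rightarrow> 'a set \<Rightarrow> 'a set"
  (infixl "\<langle>\<oplus>\<rangle>\<index>" 65)
  where "A \<langle>\<oplus>\<rangle>\<^bsub>R\<^esub> B = (\<Union>a\<in>A. \<Union>b\<in>B. a \<oplus>\<^bsub>R\<^esub> b)"

locale semihyperring =
  fixes R :: "('a, 'c) semihyperring_scheme" (structure)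
  assumes hadd_closed: "\<lbrakk>x \<in> carrier R; y \<in> carrier R\<rbrakk> \<Longrightarrow> x \<oplus> y \<subseteq> carrier R"
    and hadd_nonempty: "\<lbrakk>x \<in> carrier R; y \<in> carrier R\<rbrakk> \<Longrightarrow> x \<oplus> y \<noteq> {}"
    and hadd_commute: "\<lbrakk>x \<in> carrier R; y \<in> carrier R\<rbrakk> \<Longrightarrow> x \<oplus> y = y \<oplus> x"
    and hadd_assoc: "\<lbrakk>x \<in> carrier R; y \<in> carrier R; z \<in> carrier R\<rbrakk>
      \<Longrightarrow> (x \<oplus> y) \<langle>\<oplus>\<rangle> {z} = {x} \<langle>\<oplus>\<rangle> (y \<oplus> z)"
    and hmult_closed: "\<lbrakk>x \<in> carrier R; y \<in> carrier R\<rbrakk> \<Longrightarrow> x \<otimes> y \<in> carrier R"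
    and hmult_assoc: "\<lbrakk>x \<in> carrier R; y \<in> carrier R; z \<in> carrier R\<rbrakk>
      \<Longrightarrow> (x \<otimes> y) \<otimes> z = x \<otimes> (y \<otimes> z)"
    and distrib_left: "\<lbrakk>x \<in> carrier R; y \<in> carrier R; z \<in> carrier R\<rbrakk>
      \<Longrightarrow> (\<lambda>w. x \<otimes> w) ` (y \<oplus> z) = (x \<otimes> y) \<oplus> (x \<otimes> z)"
    and distrib_right: "\<lbrakk>x \<in> carrier R; y \<in> carrier R; z \<in> carrier R\<rbrakk>
      \<Longrightarrow> (\<lambda>w. w \<otimes> z) ` (x \<oplus> y) = (x \<otimes> z) \<oplus> (y \<otimes> z)"
    and zero_closed: "\<zero> \<in> carrier R"
    and zero_hadd: "x \<in> carrier R \<Longrightarrow> \<zero> \<oplus> x = {x}"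
    and hadd_zero: "x \<in> carrier R \<Longrightarrow> x \<oplus> \<zero> = {x}"
    and zero_hmult: "x \<in> carrier R \<Longrightarrow> \<zero> \<otimes> x = \<zero>"
    and hmult_zero: "x \<in> carrier R \<Longrightarrow> x \<otimes> \<zero> = \<zero>"

definition hyperideal :: "('a, 'c) semihyperring_scheme \<Rightarrow> 'a set \<Rightarrow> bool" where
  "hyperideal R I \<longleftrightarrow>
     I \<subseteq> carrier R \<and> I \<noteq> {} \<and>
     (\<forall>x\<in>I. \<forall>y\<in>I. x \<oplus>\<^bsub>R\<^esub> y \<subseteq> I) \<and>
     (\<forall>r\<in>carrier R. \<forall>x\<in>I. r \<otimes>\<^bsub>R\<^esub> x \<in> I \<and> x \<otimes>\<^bsub>R\<^esub> r \<in> I)"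

(* Only hypersums with at least one summand occur below; the value on the empty list is a dummy. *)
fun hypersum :: "('a, 'c) semihyperring_scheme \<Rightarrow> 'a list \<Rightarrow> 'a set" where
  "hypersum R [] = {}"
| "hypersum R [a] = {a}"
| "hypersum R (a # b # as) = {a} \<langle>\<oplus>\<rangle>\<^bsub>R\<^esub> hypersum R (b # as)"

(* The list of pairs [(y1,z1), ..., (yp,zp)] encodes the hypersum of the products yi zi. *)
definition prod_hypersum :: "('a, 'c) semihyperring_scheme \<Rightarrow> ('a \<times> 'a) list \<Rightarrow> 'a set" where
  "prod_hypersum R ps = hypersum R (map (\<lambda>(y, z). y \<otimes>\<^bsub>R\<^esub> z) ps)"

definition hyperideal_prod :: "('a, 'c) semihyperring_scheme \<Rightarrow> 'a set \<Rightarrow> 'a set \<Rightarrow> 'a set" where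
  "hyperideal_prod R I J =
     {x. \<exists>ps. ps \<noteq> [] \<and> set ps \<subseteq> I \<times> J \<and> x \<in> prod_hypersum R ps}"

definition fully_idempotent :: "('a, 'c) semihyperring_scheme \<Rightarrow> bool" where
  "fully_idempotent R \<longleftrightarrow> (\<forall>I. hyperideal R I \<longrightarrow> hyperideal_prod R I I = I)"

(* Extensional functions, so that equality of fuzzy subsets means equality on the carrier. *)
definition fuzzy_subsets :: "('a, 'c) semihyperring_scheme \<Rightarrow> ('a \<Rightarrow> real) set" where
  "fuzzy_subsets R = carrier R \<rightarrow>\<^sub>E {0..1}"

definition fuzzy_le :: "('a, 'c) semihyperring_scheme \<Rightarrow> ('a \<Rightarrow> real) \<Rightarrow> ('a \<Rightarrow> real) \<Rightarrow> bool" where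
  "fuzzy_le R l m \<longleftrightarrow> (\<forall>x\<in>carrier R. l x \<le> m x)"

definition fuzzy_hyperideal :: "('a, 'c) semihyperring_scheme \<Rightarrow> ('a \<Rightarrow> real) \<Rightarrow> bool" where
  "fuzzy_hyperideal R m \<longleftrightarrow>
     m \<in> fuzzy_subsets R \<and> m \<zero>\<^bsub>R\<^esub> = 1 \<and>
     (\<forall>x\<in>carrier R. \<forall>y\<in>carrier R.
        Inf (m ` (x \<oplus>\<^bsub>R\<^esub> y)) \<ge> min (m x) (m y) \<and>
        m (x \<otimes>\<^bsub>R\<^esub> y) \<ge> m x \<and> m (y \<otimes>\<^bsub>R\<^esub> x) \<ge> m x)"

(* Supremum in the unit interval; Sup {} is unspecified on the reals. *)
definition unit_Sup :: "real set \<Rightarrow> real" where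
  "unit_Sup A = (if A = {} then 0 else Sup A)"

definition fuzzy_inter ::
  "('a, 'c) semihyperring_scheme \<Rightarrow> ('a \<Rightarrow> real) \<Rightarrow> ('a \<Rightarrow> real) \<Rightarrow> 'a \<Rightarrow> real" where
  "fuzzy_inter R l m = (\<lambda>x\<in>carrier R. min (l x) (m x))"

definition fuzzy_sum ::
  "('a, 'c) semihyperring_scheme \<Rightarrow> ('a \<Rightarrow> real) \<Rightarrow> ('a \<Rightarrow> real) \<Rightarrow> 'a \<Rightarrow> real" where
  "fuzzy_sum R l m =
     (\<lambda>x\<in>carrier R. unit_Sup {min (l y) (m z) | y z.
        y \<in> carrier R \<and> z \<in> carrier R \<and> x \<in> y \<oplus>\<^bsub>R\<^esub> z})"

definition fuzzy_prod ::
  "('a, 'c) semihyperring_scheme \<Rightarrow> ('a \<Rightarrow> real) \<Rightarrow> ('a \<Rightarrow> real) \<Rightarrow> 'a \<Rightarrow> real" where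
  "fuzzy_prod R l m =
     (\<lambda>x\<in>carrier R. unit_Sup {Min ((\<lambda>(y, z). min (l y) (m z)) ` set ps) | ps.
        ps \<noteq> [] \<and> set ps \<subseteq> carrier R \<times> carrier R \<and> x \<in> prod_hypersum R ps})"

definition FI :: "('a, 'c) semihyperring_scheme \<Rightarrow> ('a \<Rightarrow> real) gorder" where
  "FI R = \<lparr>carrier = {m. fuzzy_hyperideal R m}, eq = (=), le = fuzzy_le R\<rparr>"

locale distributive_lattice = lattice +
  assumes meet_join_distrib:
    "\<lbrakk>x \<in> carrier L; y \<in> carrier L; z \<in> carrier L\<rbrakk> \<Longrightarrow> x \<sqinter> (y \<squnion> z) = (x \<sqinter> y) \<squnion> (x \<sqinter> z)"

end

theory Submission
  imports Defs
begin

text \<open>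
  Everything fuzzy is reduced to ordinary hyperideals by means of the strict level cuts
  \<open>{x. t < m x}\<close> for \<open>t\<close> in the half-open interval from 0 to 1.  A fuzzy subset is determined by
  these cuts, it is a fuzzy hyperideal exactly if all of them are hyperideals, and the cuts of
  the intersection, the sum and the product of two fuzzy subsets are the intersection, the
  hypersum and the product of their cuts (lemmas \<open>cut_fuzzy_inter\<close>, \<open>cut_fuzzy_sum\<close>,
  \<open>cut_fuzzy_prod\<close>).  The cuts have to be strict: a supremum exceeds \<open>t\<close> if and only if one of
  its members does, whereas it may reach \<open>t\<close> without being attained.

  Hypersum and intersection are the least upper and the greatest lower bound of two hyperideals,
  so the fuzzy hyperideals of any semihyperring form a lattice under the two fuzzy operations.
  If \<open>R\<close> is fully idempotent then \<open>I \<inter> J\<close>, being its own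
  square, lies in \<open>IJ\<close>, hence \<open>I \<inter> J = IJ\<close>.  Distributivity follows because an element of
  \<open>I \<inter> (J \<oplus> K) = I(J \<oplus> K)\<close> lies in a hypersum of products \<open>y z\<close> with \<open>z\<close> in some \<open>a \<oplus> b\<close>,
  where \<open>y\<close> is in \<open>I\<close>, \<open>a\<close> in \<open>J\<close> and \<open>b\<close> in \<open>K\<close>;
  every such \<open>y z\<close> is in \<open>y a \<oplus> y b\<close>, thus in \<open>(I \<inter> J) \<oplus> (I \<inter> K)\<close>.  Conversely, a hyperideal is a
  cut of its characteristic function, so that equality of fuzzy intersection and fuzzy product,
  both formed from this function and itself, gives back \<open>I = I\<^sup>2\<close>.
\<close>

section \<open>Hyperideals\<close>

context semihyperring
begin

lemma hadd_assoc_right: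
  assumes "x \<in> carrier R" "y \<in> carrier R" "z \<in> carrier R" "u \<in> x \<oplus> y" "w \<in> u \<oplus> z"
  obtains v where "v \<in> y \<oplus> z" "w \<in> x \<oplus> v"
proof -
  have "w \<in> (x \<oplus> y) \<langle>\<oplus>\<rangle> {z}"
    using assms by (auto simp: set_hadd_def)
  then have "w \<in> {x} \<langle>\<oplus>\<rangle> (y \<oplus> z)"
    using assms(1-3) by (simp add: hadd_assoc)
  then show ?thesis
    using that by (auto simp: set_hadd_def)
qed

lemma hadd_assoc_left:
  assumes "x \<in> carrier R" "y \<in> carrier R" "z \<in> carrier R" "v \<in> y \<oplus> z" "w \<in> x \<oplus> v"
  obtains u where "u \<in> x \<oplus> y" "w \<in> u \<oplus> z"
proof -
  have "w \<in> {x} \<langle>\<oplus>\<rangle> (y \<oplus> z)"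
    using assms by (auto simp: set_hadd_def)
  then have "w \<in> (x \<oplus> y) \<langle>\<oplus>\<rangle> {z}"
    using assms(1-3) by (simp add: hadd_assoc)
  then show ?thesis
    using that by (auto simp: set_hadd_def)
qed

text \<open>
  Elementwise form of \<open>(a \<oplus> b) \<oplus> (c \<oplus> d) = (a \<oplus> c) \<oplus> (b \<oplus> d)\<close>, which makes the hypersum of
  two hyperideals closed under hyperaddition.
\<close>

lemma hadd_interchange:
  assumes carr: "a \<in> carrier R" "b \<in> carrier R" "c \<in> carrier R" "d \<in> carrier R"
    and x: "x \<in> a \<oplus> b" and y: "y \<in> c \<oplus> d" and w: "w \<in> x \<oplus> y"
  obtains u v where "u \<in> a \<oplus> c" "v \<in> b \<oplus> d" "w \<in> u \<oplus> v"
proof -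
  have yc: "y \<in> carrier R"
    using hadd_closed carr y by blast
  obtain p where p: "p \<in> b \<oplus> y" "w \<in> a \<oplus> p"
    using hadd_assoc_right[OF carr(1,2) yc x w] .
  have "p \<in> y \<oplus> b"
    using p carr yc hadd_commute by blast
  then obtain q where q: "q \<in> d \<oplus> b" "p \<in> c \<oplus> q"
    using hadd_assoc_right[OF carr(3,4,2) y] by blast
  have "q \<in> carrier R"
    using q carr hadd_closed by blast
  then obtain u where "u \<in> a \<oplus> c" "w \<in> u \<oplus> q"
    using hadd_assoc_left[OF carr(1,3) _ q(2) p(2)] by blast
  then show ?thesis
    using that q carr hadd_commute by blast
qed

lemma hyperideal_zero: "hyperideal R I \<Longrightarrow> \<zero> \<in> I"
  unfolding hyperideal_def using zero_closed zero_hmult by (metis all_not_in_conv subsetD)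

lemma hyperideal_Int:
  assumes "hyperideal R I" "hyperideal R J"
  shows "hyperideal R (I \<inter> J)"
proof -
  have "\<zero> \<in> I \<inter> J"
    using assms hyperideal_zero by blast
  then show ?thesis
    using assms unfolding hyperideal_def by blast
qed

lemma hypersum_subset:
  assumes "\<And>x y. \<lbrakk>x \<in> S; y \<in> S\<rbrakk> \<Longrightarrow> x \<oplus> y \<subseteq> S" "set xs \<subseteq> S"
  shows "hypersum R xs \<subseteq> S"
  using assms(2)
proof (induction xs rule: induct_list012)
  case (3 a b as)
  then have "hypersum R (b # as) \<subseteq> S" "a \<in> S"
    by auto
  then show ?case
    using assms(1) by (fastforce simp: set_hadd_def)
qed auto

lemma hyperideal_prod_subset:
  assumes "\<And>x y. \<lbrakk>x \<in> S; y \<in> S\<rbrakk> \<Longrightarrow> x \<oplus> y \<subseteq> S"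
    and "\<And>y z. \<lbrakk>y \<in> I; z \<in> J\<rbrakk> \<Longrightarrow> y \<otimes> z \<in> S"
  shows "hyperideal_prod R I J \<subseteq> S"
proof
  fix x assume "x \<in> hyperideal_prod R I J"
  then obtain ps where ps: "set ps \<subseteq> I \<times> J" "x \<in> hypersum R (map (\<lambda>(y, z). y \<otimes> z) ps)"
    by (auto simp: hyperideal_prod_def prod_hypersum_def)
  have "set (map (\<lambda>(y, z). y \<otimes> z) ps) \<subseteq> S"
    using ps(1) assms(2) by auto
  then show "x \<in> S"
    using hypersum_subset[OF assms(1)] ps(2) by blast
qed

lemma hyperideal_prod_subset_Int:
  assumes "hyperideal R I" "hyperideal R J"
  shows "hyperideal_prod R I J \<subseteq> I \<inter> J"
  using assms by (intro hyperideal_prod_subset) (auto simp: hyperideal_def)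

lemma hyperideal_prod_mono:
  "\<lbrakk>I \<subseteq> I'; J \<subseteq> J'\<rbrakk> \<Longrightarrow> hyperideal_prod R I J \<subseteq> hyperideal_prod R I' J'"
  unfolding hyperideal_prod_def by blast

lemma hyperideal_set_hadd:
  assumes I: "hyperideal R I" and J: "hyperideal R J"
  shows "hyperideal R (I \<langle>\<oplus>\<rangle> J)"
  unfolding hyperideal_def
proof (intro conjI ballI)
  have carr: "I \<subseteq> carrier R" "J \<subseteq> carrier R"
    using I J by (auto simp: hyperideal_def)
  show "I \<langle>\<oplus>\<rangle> J \<subseteq> carrier R"
    using carr hadd_closed unfolding set_hadd_def by blast
  show "I \<langle>\<oplus>\<rangle> J \<noteq> {}"
    using hyperideal_zero[OF I] hyperideal_zero[OF J] hadd_nonempty[OF zero_closed zero_closed]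
    unfolding set_hadd_def by blast
  show "x \<oplus> y \<subseteq> I \<langle>\<oplus>\<rangle> J" if x: "x \<in> I \<langle>\<oplus>\<rangle> J" and y: "y \<in> I \<langle>\<oplus>\<rangle> J" for x y
  proof
    fix w assume w: "w \<in> x \<oplus> y"
    obtain a b where ab: "a \<in> I" "b \<in> J" "x \<in> a \<oplus> b"
      using x by (auto simp: set_hadd_def)
    obtain c d where cd: "c \<in> I" "d \<in> J" "y \<in> c \<oplus> d"
      using y by (auto simp: set_hadd_def)
    obtain u v where "u \<in> a \<oplus> c" "v \<in> b \<oplus> d" "w \<in> u \<oplus> v"
      using hadd_interchange[of a b c d x y w] ab cd carr w by blast
    moreover from this have "u \<in> I" "v \<in> J"
      using I J ab cd unfolding hyperideal_def by blast+
    ultimately show "w \<in> I \<langle>\<oplus>\<rangle> J"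
      by (auto simp: set_hadd_def)
  qed
  fix r x assume r: "r \<in> carrier R" and x: "x \<in> I \<langle>\<oplus>\<rangle> J"
  obtain a b where ab: "a \<in> I" "b \<in> J" "x \<in> a \<oplus> b"
    using x by (auto simp: set_hadd_def)
  then have abc: "a \<in> carrier R" "b \<in> carrier R"
    using carr by auto
  have "r \<otimes> x \<in> (r \<otimes> a) \<oplus> (r \<otimes> b)" "x \<otimes> r \<in> (a \<otimes> r) \<oplus> (b \<otimes> r)"
    unfolding distrib_left[OF r abc, symmetric] distrib_right[OF abc r, symmetric]
    using ab(3) by (rule imageI)+
  moreover have "r \<otimes> a \<in> I" "a \<otimes> r \<in> I" "r \<otimes> b \<in> J" "b \<otimes> r \<in> J"
    using I J ab r unfolding hyperideal_def by blast+
  ultimately show "r \<otimes> x \<in> I \<langle>\<oplus>\<rangle> J" "x \<otimes> r \<in> I \<langle>\<oplus>\<rangle> J"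
    by (auto simp: set_hadd_def)
qed

lemma subset_set_hadd:
  assumes "hyperideal R I" "hyperideal R J"
  shows "I \<subseteq> I \<langle>\<oplus>\<rangle> J" "J \<subseteq> I \<langle>\<oplus>\<rangle> J"
proof -
  have sub: "I \<subseteq> carrier R" "J \<subseteq> carrier R" and zero: "\<zero> \<in> I" "\<zero> \<in> J"
    using assms hyperideal_zero by (auto simp: hyperideal_def)
  show "I \<subseteq> I \<langle>\<oplus>\<rangle> J"
  proof
    fix x assume "x \<in> I"
    moreover from this have "x \<in> x \<oplus> \<zero>"
      using sub(1) by (simp add: hadd_zero subset_iff)
    ultimately show "x \<in> I \<langle>\<oplus>\<rangle> J"
      using zero(2) unfolding set_hadd_def by blast
  qed
  show "J \<subseteq> I \<langle>\<oplus>\<rangle> J"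
  proof
    fix x assume "x \<in> J"
    moreover from this have "x \<in> \<zero> \<oplus> x"
      using sub(2) by (simp add: zero_hadd subset_iff)
    ultimately show "x \<in> I \<langle>\<oplus>\<rangle> J"
      using zero(1) unfolding set_hadd_def by blast
  qed
qed

lemma set_hadd_least:
  assumes "hyperideal R K" "I \<subseteq> K" "J \<subseteq> K"
  shows "I \<langle>\<oplus>\<rangle> J \<subseteq> K"
  using assms unfolding hyperideal_def set_hadd_def by blast

section \<open>Fully idempotent semihyperrings\<close>

text \<open>By full idempotence the hyperideal \<open>I \<inter> J\<close> is its own square, and this square is contained in \<open>IJ\<close>.\<close>

lemma fully_idempotent_Int_eq_prod:
  assumes "fully_idempotent R" "hyperideal R I" "hyperideal R J"
  shows "I \<inter> J = hyperideal_prod R I J"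
proof
  have "I \<inter> J = hyperideal_prod R (I \<inter> J) (I \<inter> J)"
    using assms hyperideal_Int unfolding fully_idempotent_def by metis
  also have "\<dots> \<subseteq> hyperideal_prod R I J"
    by (intro hyperideal_prod_mono) auto
  finally show "I \<inter> J \<subseteq> hyperideal_prod R I J" .
qed (rule hyperideal_prod_subset_Int[OF assms(2,3)])

text \<open>
  The inclusion from left to right rests on the description of the intersection as a product,
  since multiplication, unlike intersection, distributes over the hyperaddition.
\<close>

lemma fully_idempotent_Int_set_hadd_distrib:
  assumes fi: "fully_idempotent R"
    and I: "hyperideal R I" and J: "hyperideal R J" and K: "hyperideal R K"
  shows "I \<inter> (J \<langle>\<oplus>\<rangle> K) = (I \<inter> J) \<langle>\<oplus>\<rangle> (I \<inter> K)"
proof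
  have IJ: "hyperideal R (I \<inter> J)" and IK: "hyperideal R (I \<inter> K)"
    using I J K hyperideal_Int by auto
  have "I \<inter> (J \<langle>\<oplus>\<rangle> K) = hyperideal_prod R I (J \<langle>\<oplus>\<rangle> K)"
    using fully_idempotent_Int_eq_prod[OF fi I hyperideal_set_hadd[OF J K]] .
  also have "\<dots> \<subseteq> (I \<inter> J) \<langle>\<oplus>\<rangle> (I \<inter> K)"
  proof (rule hyperideal_prod_subset)
    show "x \<oplus> y \<subseteq> (I \<inter> J) \<langle>\<oplus>\<rangle> (I \<inter> K)"
      if "x \<in> (I \<inter> J) \<langle>\<oplus>\<rangle> (I \<inter> K)" "y \<in> (I \<inter> J) \<langle>\<oplus>\<rangle> (I \<inter> K)" for x y
      using that hyperideal_set_hadd[OF IJ IK] by (simp add: hyperideal_def)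
    fix y z assume y: "y \<in> I" and "z \<in> J \<langle>\<oplus>\<rangle> K"
    then obtain a b where ab: "a \<in> J" "b \<in> K" "z \<in> a \<oplus> b"
      by (auto simp: set_hadd_def)
    then have carr: "y \<in> carrier R" "a \<in> carrier R" "b \<in> carrier R"
      using I J K y by (auto simp: hyperideal_def)
    have "y \<otimes> z \<in> (y \<otimes> a) \<oplus> (y \<otimes> b)"
      using distrib_left[OF carr] ab by blast
    moreover have "y \<otimes> a \<in> I \<inter> J" "y \<otimes> b \<in> I \<inter> K"
      using I J K y ab carr unfolding hyperideal_def by blast+
    ultimately show "y \<otimes> z \<in> (I \<inter> J) \<langle>\<oplus>\<rangle> (I \<inter> K)"
      by (auto simp: set_hadd_def)
  qed
  finally show "I \<inter> (J \<langle>\<oplus>\<rangle> K) \<subseteq> (I \<inter> J) \<langle>\<oplus>\<rangle> (I \<inter> K)" .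
  show "(I \<inter> J) \<langle>\<oplus>\<rangle> (I \<inter> K) \<subseteq> I \<inter> (J \<langle>\<oplus>\<rangle> K)"
    using I unfolding hyperideal_def set_hadd_def by blast
qed

end

section \<open>Strict level cuts of fuzzy subsets\<close>

definition cut :: "('a, 'c) semihyperring_scheme \<Rightarrow> ('a \<Rightarrow> real) \<Rightarrow> real \<Rightarrow> 'a set" where
  "cut R m t = {x \<in> carrier R. t < m x}"

lemma fuzzy_subsets_bounds:
  "\<lbrakk>m \<in> fuzzy_subsets R; x \<in> carrier R\<rbrakk> \<Longrightarrow> 0 \<le> m x \<and> m x \<le> 1"
  by (auto simp: fuzzy_subsets_def PiE_iff)

text \<open>If \<open>m x < l x\<close> then \<open>m x\<close> itself is a level at which the cuts are not nested.\<close>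

lemma fuzzy_le_iff_cut:
  assumes "l \<in> fuzzy_subsets R" "m \<in> fuzzy_subsets R"
  shows "fuzzy_le R l m \<longleftrightarrow> (\<forall>t\<in>{0..<1}. cut R l t \<subseteq> cut R m t)"
proof
  show "fuzzy_le R l m \<Longrightarrow> \<forall>t\<in>{0..<1}. cut R l t \<subseteq> cut R m t"
    by (force simp: fuzzy_le_def cut_def)
  assume cuts: "\<forall>t\<in>{0..<1}. cut R l t \<subseteq> cut R m t"
  show "fuzzy_le R l m"
    unfolding fuzzy_le_def
  proof (intro ballI leI notI)
    fix x assume x: "x \<in> carrier R" "m x < l x"
    then have "m x \<in> {0..<1}"
      using fuzzy_subsets_bounds[OF assms(1)] fuzzy_subsets_bounds[OF assms(2)] by force
    with cuts x show False
      by (auto simp: cut_def)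
  qed
qed

lemma fuzzy_le_antisym:
  assumes "l \<in> fuzzy_subsets R" "m \<in> fuzzy_subsets R" "fuzzy_le R l m" "fuzzy_le R m l"
  shows "l = m"
  using assms(1,2) unfolding fuzzy_subsets_def
proof (rule PiE_ext)
  show "l x = m x" if "x \<in> carrier R" for x
    using assms(3,4) that by (simp add: fuzzy_le_def order_antisym)
qed

lemma fuzzy_eqI_cut:
  assumes "l \<in> fuzzy_subsets R" "m \<in> fuzzy_subsets R"
    and "\<And>t. t \<in> {0..<1} \<Longrightarrow> cut R l t = cut R m t"
  shows "l = m"
  using assms by (intro fuzzy_le_antisym) (auto simp: fuzzy_le_iff_cut)

lemma (in semihyperring) fuzzy_hyperideal_iff_cut:
  "fuzzy_hyperideal R m \<longleftrightarrow>
     m \<in> fuzzy_subsets R \<and> (\<forall>t\<in>{0..<1}. hyperideal R (cut R m t))"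
proof (intro iffI conjI ballI)
  assume m: "fuzzy_hyperideal R m"
  then show sub: "m \<in> fuzzy_subsets R"
    by (simp add: fuzzy_hyperideal_def)
  fix t :: real assume t: "t \<in> {0..<1}"
  have zero: "\<zero> \<in> cut R m t"
    using m t zero_closed by (simp add: fuzzy_hyperideal_def cut_def)
  have "t < m z" if "x \<in> cut R m t" "y \<in> cut R m t" "z \<in> x \<oplus> y" for x y z
  proof -
    have xy: "x \<in> carrier R" "y \<in> carrier R" "t < min (m x) (m y)"
      using that by (auto simp: cut_def)
    have "bdd_below (m ` (x \<oplus> y))"
      using fuzzy_subsets_bounds[OF sub] hadd_closed[OF xy(1,2)]
      by (intro bdd_belowI2[where m = 0]) blast
    then have "Inf (m ` (x \<oplus> y)) \<le> m z"
      using that(3) by (rule cINF_lower)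
    moreover have "min (m x) (m y) \<le> Inf (m ` (x \<oplus> y))"
      using m xy(1,2) unfolding fuzzy_hyperideal_def by blast
    ultimately show ?thesis
      using xy(3) by linarith
  qed
  then have "x \<oplus> y \<subseteq> cut R m t" if "x \<in> cut R m t" "y \<in> cut R m t" for x y
    using that hadd_closed[of x y] unfolding cut_def by blast
  moreover have "r \<otimes> x \<in> cut R m t" "x \<otimes> r \<in> cut R m t"
    if r: "r \<in> carrier R" and x: "x \<in> cut R m t" for r x
  proof -
    have xc: "x \<in> carrier R" "t < m x"
      using x by (auto simp: cut_def)
    then have "m x \<le> m (r \<otimes> x)" "m x \<le> m (x \<otimes> r)"
      using m r unfolding fuzzy_hyperideal_def by blast+
    with xc r show "r \<otimes> x \<in> cut R m t" "x \<otimes> r \<in> cut R m t"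
      by (auto simp: cut_def hmult_closed)
  qed
  moreover have "cut R m t \<subseteq> carrier R"
    by (auto simp: cut_def)
  ultimately show "hyperideal R (cut R m t)"
    unfolding hyperideal_def using zero by blast
next
  assume m: "m \<in> fuzzy_subsets R \<and> (\<forall>t\<in>{0..<1}. hyperideal R (cut R m t))"
  note bounds = fuzzy_subsets_bounds[OF conjunct1[OF m]]
  have ideal: "hyperideal R (cut R m (m z))" if "z \<in> carrier R" "m z < 1" for z
    using m bounds that by simp
  \<comment> \<open>If \<open>z\<close> is the point at which one of the required inequalities fails, then the cut at level
    \<open>m z\<close>, which never contains \<open>z\<close>, would have to contain it.\<close>
  have notin: "z \<notin> cut R m (m z)" for z
    by (simp add: cut_def)
  show "fuzzy_hyperideal R m"
    unfolding fuzzy_hyperideal_def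
  proof (intro conjI ballI)
    show "m \<in> fuzzy_subsets R"
      using m by simp
    have "\<not> m \<zero> < 1"
      using hyperideal_zero[OF ideal[OF zero_closed]] notin by blast
    then show "m \<zero> = 1"
      using bounds[OF zero_closed] by simp
    fix x y assume x: "x \<in> carrier R" and y: "y \<in> carrier R"
    show "min (m x) (m y) \<le> Inf (m ` (x \<oplus> y))"
    proof (rule cINF_greatest[OF hadd_nonempty[OF x y]], rule ccontr)
      fix z assume "z \<in> x \<oplus> y" "\<not> min (m x) (m y) \<le> m z"
      then have z: "z \<in> x \<oplus> y" "m z < min (m x) (m y)"
        by auto
      have zc: "z \<in> carrier R"
        using z hadd_closed x y by blast
      have "m z < 1"
        using z(2) bounds[OF x] by linarith
      moreover have "x \<in> cut R m (m z)" "y \<in> cut R m (m z)"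
        using x y z by (auto simp: cut_def)
      ultimately have "x \<oplus> y \<subseteq> cut R m (m z)"
        using ideal[OF zc] by (simp add: hyperideal_def)
      then show False
        using z(1) notin by blast
    qed
    have "\<not> m z < m x" if z: "z = x \<otimes> y \<or> z = y \<otimes> x" for z
    proof
      assume less: "m z < m x"
      have "z \<in> carrier R"
        using z x y hmult_closed by blast
      moreover have "m z < 1"
        using less bounds[OF x] by linarith
      moreover have "x \<in> cut R m (m z)"
        using x less by (simp add: cut_def)
      ultimately have "x \<otimes> y \<in> cut R m (m z)" "y \<otimes> x \<in> cut R m (m z)"
        using ideal[of z] y by (simp_all add: hyperideal_def)
      then show False
        using z notin[of z] by auto
    qed
    then show "m x \<le> m (x \<otimes> y)" "m x \<le> m (y \<otimes> x)"
      by (simp_all add: not_less)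
  qed
qed

section \<open>Cuts of the fuzzy operations\<close>

text \<open>
  The bound \<open>0 \<le> t\<close> accounts for the empty set, whose supremum in the unit interval is 0.  It is
  the reason why only cuts at nonnegative levels are compared.
\<close>

lemma less_unit_Sup_iff:
  assumes "A \<subseteq> {0..1}" "0 \<le> t"
  shows "t < unit_Sup A \<longleftrightarrow> (\<exists>a\<in>A. t < a)"
proof (cases "A = {}")
  case False
  have "bdd_above A"
    using assms(1) by (meson bdd_above_Icc bdd_above_mono)
  with False show ?thesis
    by (simp add: unit_Sup_def less_cSup_iff)
qed (use assms in \<open>simp add: unit_Sup_def\<close>)

lemma unit_Sup_bounds:
  assumes "A \<subseteq> {0..1}"
  shows "unit_Sup A \<in> {0..1}"
proof (cases "A = {}")
  case False
  then obtain a where a: "a \<in> A"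
    by blast
  have "bdd_above A"
    using assms by (meson bdd_above_Icc bdd_above_mono)
  then have "a \<le> Sup A"
    using a by (simp add: cSup_upper)
  moreover have "Sup A \<le> 1"
    using False assms by (intro cSup_least) auto
  ultimately show ?thesis
    using assms a False by (force simp: unit_Sup_def)
qed (simp add: unit_Sup_def)

context
  fixes R :: "('a, 'c) semihyperring_scheme" and l m :: "'a \<Rightarrow> real"
  assumes l: "l \<in> fuzzy_subsets R" and m: "m \<in> fuzzy_subsets R"
begin

lemma fuzzy_inter_closed: "fuzzy_inter R l m \<in> fuzzy_subsets R"
  using l m by (auto simp: fuzzy_subsets_def fuzzy_inter_def PiE_iff min_le_iff_disj)

lemma cut_fuzzy_inter: "cut R (fuzzy_inter R l m) t = cut R l t \<inter> cut R m t"
  by (auto simp: cut_def fuzzy_inter_def)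

lemma fuzzy_sum_values_subset:
  "{min (l y) (m z) | y z. y \<in> carrier R \<and> z \<in> carrier R \<and> x \<in> y \<oplus>\<^bsub>R\<^esub> z} \<subseteq> {0..1}"
  using fuzzy_subsets_bounds[OF l] fuzzy_subsets_bounds[OF m] by (auto simp: min_le_iff_disj)

lemma fuzzy_sum_closed: "fuzzy_sum R l m \<in> fuzzy_subsets R"
  using unit_Sup_bounds[OF fuzzy_sum_values_subset]
  by (simp add: fuzzy_subsets_def fuzzy_sum_def PiE_iff)

lemma fuzzy_prod_values_subset:
  "{Min ((\<lambda>(y, z). min (l y) (m z)) ` set ps) | ps.
      ps \<noteq> [] \<and> set ps \<subseteq> carrier R \<times> carrier R \<and> x \<in> prod_hypersum R ps} \<subseteq> {0..1}"
proof clarify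
  fix ps :: "('a \<times> 'a) list"
  assume ps: "ps \<noteq> []" "set ps \<subseteq> carrier R \<times> carrier R"
  let ?V = "(\<lambda>(y, z). min (l y) (m z)) ` set ps"
  have "?V \<subseteq> {0..1}"
    using ps(2) fuzzy_subsets_bounds[OF l] fuzzy_subsets_bounds[OF m]
    by (force simp: min_le_iff_disj)
  moreover have "Min ?V \<in> ?V"
    using ps(1) by (intro Min_in) auto
  ultimately show "Min ?V \<in> {0..1}"
    by blast
qed

lemma fuzzy_prod_closed: "fuzzy_prod R l m \<in> fuzzy_subsets R"
  using unit_Sup_bounds[OF fuzzy_prod_values_subset]
  by (simp add: fuzzy_subsets_def fuzzy_prod_def PiE_iff)

lemma cut_fuzzy_sum:
  assumes "semihyperring R" "0 \<le> t"
  shows "cut R (fuzzy_sum R l m) t = cut R l t \<langle>\<oplus>\<rangle>\<^bsub>R\<^esub> cut R m t"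
proof -
  have "t < fuzzy_sum R l m x \<longleftrightarrow> x \<in> cut R l t \<langle>\<oplus>\<rangle>\<^bsub>R\<^esub> cut R m t" if "x \<in> carrier R" for x
  proof -
    have "t < fuzzy_sum R l m x \<longleftrightarrow> (\<exists>a\<in>{min (l y) (m z) | y z.
        y \<in> carrier R \<and> z \<in> carrier R \<and> x \<in> y \<oplus>\<^bsub>R\<^esub> z}. t < a)"
      using that unfolding less_unit_Sup_iff[OF fuzzy_sum_values_subset assms(2), symmetric]
      by (simp add: fuzzy_sum_def)
    also have "\<dots> \<longleftrightarrow> (\<exists>y z. y \<in> carrier R \<and> z \<in> carrier R \<and> x \<in> y \<oplus>\<^bsub>R\<^esub> z \<and> t < min (l y) (m z))"
      by blast
    finally show ?thesis
      by (auto simp: set_hadd_def cut_def)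
  qed
  moreover have "cut R l t \<langle>\<oplus>\<rangle>\<^bsub>R\<^esub> cut R m t \<subseteq> carrier R"
    using semihyperring.hadd_closed[OF assms(1)] by (fastforce simp: set_hadd_def cut_def)
  ultimately show ?thesis
    by (auto simp: cut_def[of R "fuzzy_sum R l m"])
qed

lemma cut_fuzzy_prod:
  assumes "semihyperring R" "0 \<le> t"
  shows "cut R (fuzzy_prod R l m) t = hyperideal_prod R (cut R l t) (cut R m t)"
proof -
  have Min_iff: "t < Min ((\<lambda>(y, z). min (l y) (m z)) ` set ps) \<and> set ps \<subseteq> carrier R \<times> carrier R
      \<longleftrightarrow> set ps \<subseteq> cut R l t \<times> cut R m t" if "ps \<noteq> []" for ps
    using that by (auto simp: cut_def)
  have "t < fuzzy_prod R l m x \<longleftrightarrow> x \<in> hyperideal_prod R (cut R l t) (cut R m t)"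
    if "x \<in> carrier R" for x
  proof -
    have "t < fuzzy_prod R l m x \<longleftrightarrow> (\<exists>a\<in>{Min ((\<lambda>(y, z). min (l y) (m z)) ` set ps) | ps.
        ps \<noteq> [] \<and> set ps \<subseteq> carrier R \<times> carrier R \<and> x \<in> prod_hypersum R ps}. t < a)"
      using that unfolding less_unit_Sup_iff[OF fuzzy_prod_values_subset assms(2), symmetric]
      by (simp add: fuzzy_prod_def)
    also have "\<dots> \<longleftrightarrow> (\<exists>ps. ps \<noteq> [] \<and> (t < Min ((\<lambda>(y, z). min (l y) (m z)) ` set ps) \<and>
        set ps \<subseteq> carrier R \<times> carrier R) \<and> x \<in> prod_hypersum R ps)"
      by blast
    also have "\<dots> \<longleftrightarrow> x \<in> hyperideal_prod R (cut R l t) (cut R m t)"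
      unfolding hyperideal_prod_def mem_Collect_eq
      by (intro ex_cong1 conj_cong refl Min_iff)
    finally show ?thesis .
  qed
  moreover have "hyperideal_prod R (cut R l t) (cut R m t) \<subseteq> carrier R"
    using semihyperring.hadd_closed[OF assms(1)] semihyperring.hmult_closed[OF assms(1)]
    by (intro semihyperring.hyperideal_prod_subset[OF assms(1)]) (auto simp: cut_def)
  ultimately show ?thesis
    by (auto simp: cut_def[of R "fuzzy_prod R l m"])
qed

end

section \<open>The lattice of fuzzy hyperideals\<close>

context semihyperring
begin

lemma fuzzy_hyperideal_subset: "fuzzy_hyperideal R m \<Longrightarrow> m \<in> fuzzy_subsets R"
  by (simp add: fuzzy_hyperideal_def)

lemma hyperideal_cut: "\<lbrakk>fuzzy_hyperideal R m; t \<in> {0..<1}\<rbrakk> \<Longrightarrow> hyperideal R (cut R m t)"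
  by (simp add: fuzzy_hyperideal_iff_cut)

lemma fuzzy_hyperideal_inter:
  assumes "fuzzy_hyperideal R l" "fuzzy_hyperideal R m"
  shows "fuzzy_hyperideal R (fuzzy_inter R l m)"
  using assms
  by (simp add: fuzzy_hyperideal_iff_cut fuzzy_inter_closed cut_fuzzy_inter hyperideal_Int)

lemma fuzzy_hyperideal_sum:
  assumes "fuzzy_hyperideal R l" "fuzzy_hyperideal R m"
  shows "fuzzy_hyperideal R (fuzzy_sum R l m)"
  using assms
  by (simp add: fuzzy_hyperideal_iff_cut fuzzy_sum_closed cut_fuzzy_sum semihyperring_axioms
      hyperideal_set_hadd)

lemma partial_order_FI: "partial_order (FI R)"
proof
  fix l m n
  assume "l \<sqsubseteq>\<^bsub>FI R\<^esub> m" "m \<sqsubseteq>\<^bsub>FI R\<^esub> n"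
  then show "l \<sqsubseteq>\<^bsub>FI R\<^esub> n"
    by (fastforce simp: FI_def fuzzy_le_def)
qed (auto simp: FI_def fuzzy_le_def[of R l l for l] intro: fuzzy_le_antisym fuzzy_hyperideal_subset)

lemma least_fuzzy_sum:
  assumes l: "fuzzy_hyperideal R l" and m: "fuzzy_hyperideal R m"
  shows "least (FI R) (fuzzy_sum R l m) (Upper (FI R) {l, m})"
proof (rule least_UpperI)
  note sub = fuzzy_hyperideal_subset[OF l] fuzzy_hyperideal_subset[OF m]
  note cut_sum = cut_fuzzy_sum[OF sub semihyperring_axioms]
  show "{l, m} \<subseteq> carrier (FI R)" "fuzzy_sum R l m \<in> carrier (FI R)"
    using l m fuzzy_hyperideal_sum by (auto simp: FI_def)
  have "fuzzy_le R l (fuzzy_sum R l m)" "fuzzy_le R m (fuzzy_sum R l m)"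
    using subset_set_hadd[OF hyperideal_cut[OF l] hyperideal_cut[OF m]]
    by (auto simp: fuzzy_le_iff_cut sub fuzzy_sum_closed cut_sum)
  then show "x \<sqsubseteq>\<^bsub>FI R\<^esub> fuzzy_sum R l m" if "x \<in> {l, m}" for x
    using that by (auto simp: FI_def)
  fix n assume "n \<in> Upper (FI R) {l, m}"
  then have n: "fuzzy_hyperideal R n" and le: "fuzzy_le R l n" "fuzzy_le R m n"
    using l m by (auto simp: FI_def Upper_def)
  note sub_n = fuzzy_hyperideal_subset[OF n]
  have "fuzzy_le R (fuzzy_sum R l m) n"
    using le set_hadd_least[OF hyperideal_cut[OF n]]
    by (simp add: fuzzy_le_iff_cut sub sub_n fuzzy_sum_closed cut_sum)
  then show "fuzzy_sum R l m \<sqsubseteq>\<^bsub>FI R\<^esub> n"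
    by (simp add: FI_def)
qed

lemma greatest_fuzzy_inter:
  assumes "fuzzy_hyperideal R l" "fuzzy_hyperideal R m"
  shows "greatest (FI R) (fuzzy_inter R l m) (Lower (FI R) {l, m})"
  using assms fuzzy_hyperideal_inter[OF assms]
  by (intro greatest_LowerI) (auto simp: FI_def Lower_def fuzzy_le_def fuzzy_inter_def)

lemma lattice_FI: "lattice (FI R)"
proof -
  interpret partial_order "FI R"
    by (rule partial_order_FI)
  show ?thesis
  proof
    fix l m assume "l \<in> carrier (FI R)" "m \<in> carrier (FI R)"
    then have "fuzzy_hyperideal R l" "fuzzy_hyperideal R m"
      by (simp_all add: FI_def)
    then show "\<exists>s. least (FI R) s (Upper (FI R) {l, m})"
      "\<exists>s. greatest (FI R) s (Lower (FI R) {l, m})"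
      using least_fuzzy_sum greatest_fuzzy_inter by blast+
  qed
qed

lemma join_FI:
  assumes "l \<in> carrier (FI R)" "m \<in> carrier (FI R)"
  shows "l \<squnion>\<^bsub>FI R\<^esub> m = fuzzy_sum R l m"
proof -
  interpret partial_order "FI R"
    by (rule partial_order_FI)
  have "least (FI R) (fuzzy_sum R l m) (Upper (FI R) {l, m})"
    using assms least_fuzzy_sum by (simp add: FI_def)
  then show ?thesis
    unfolding join_def sup_def by (blast intro: some_equality least_unique)
qed

lemma meet_FI:
  assumes "l \<in> carrier (FI R)" "m \<in> carrier (FI R)"
  shows "l \<sqinter>\<^bsub>FI R\<^esub> m = fuzzy_inter R l m"
proof -
  interpret partial_order "FI R"
    by (rule partial_order_FI)
  have "greatest (FI R) (fuzzy_inter R l m) (Lower (FI R) {l, m})"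
    using assms greatest_fuzzy_inter by (simp add: FI_def)
  then show ?thesis
    unfolding meet_def inf_def by (blast intro: some_equality greatest_unique)
qed

lemma fully_idempotent_fuzzy_inter_eq_prod:
  assumes "fully_idempotent R" "fuzzy_hyperideal R l" "fuzzy_hyperideal R m"
  shows "fuzzy_inter R l m = fuzzy_prod R l m"
proof (rule fuzzy_eqI_cut)
  note sub = assms(2,3)[THEN fuzzy_hyperideal_subset]
  show "fuzzy_inter R l m \<in> fuzzy_subsets R" "fuzzy_prod R l m \<in> fuzzy_subsets R"
    using sub by (auto intro: fuzzy_inter_closed fuzzy_prod_closed)
  show "cut R (fuzzy_inter R l m) t = cut R (fuzzy_prod R l m) t" if "t \<in> {0..<1}" for t
    using that fully_idempotent_Int_eq_prod[OF assms(1) hyperideal_cut[OF assms(2) that]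
        hyperideal_cut[OF assms(3) that]]
    by (simp add: cut_fuzzy_inter sub cut_fuzzy_prod semihyperring_axioms)
qed

lemma fully_idempotent_fuzzy_distrib:
  assumes "fully_idempotent R" "fuzzy_hyperideal R l" "fuzzy_hyperideal R m" "fuzzy_hyperideal R n"
  shows "fuzzy_inter R l (fuzzy_sum R m n) = fuzzy_sum R (fuzzy_inter R l m) (fuzzy_inter R l n)"
proof (rule fuzzy_eqI_cut)
  note sub = assms(2-4)[THEN fuzzy_hyperideal_subset]
  note closed = sub fuzzy_inter_closed fuzzy_sum_closed
  show "fuzzy_inter R l (fuzzy_sum R m n) \<in> fuzzy_subsets R"
    "fuzzy_sum R (fuzzy_inter R l m) (fuzzy_inter R l n) \<in> fuzzy_subsets R"
    by (simp_all add: closed)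
  show "cut R (fuzzy_inter R l (fuzzy_sum R m n)) t
      = cut R (fuzzy_sum R (fuzzy_inter R l m) (fuzzy_inter R l n)) t" if t: "t \<in> {0..<1}" for t
    using t fully_idempotent_Int_set_hadd_distrib[OF assms(1) assms(2-4)[THEN hyperideal_cut, OF t]]
    by (simp add: closed cut_fuzzy_inter cut_fuzzy_sum semihyperring_axioms)
qed

text \<open>
  The cuts of the characteristic function of \<open>I\<close> at levels \<open>t\<close> with \<open>0 \<le> t < 1\<close> are all equal
  to \<open>I\<close>; comparing those of the fuzzy
  intersection and of the fuzzy product at level 0 gives \<open>I = I\<^sup>2\<close>.
\<close>

lemma fully_idempotent_if_fuzzy_inter_eq_prod:
  assumes "\<And>l. fuzzy_hyperideal R l \<Longrightarrow> fuzzy_inter R l l = fuzzy_prod R l l"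
  shows "fully_idempotent R"
  unfolding fully_idempotent_def
proof (intro allI impI)
  fix I assume I: "hyperideal R I"
  define chi :: "'a \<Rightarrow> real" where "chi = (\<lambda>x\<in>carrier R. if x \<in> I then 1 else 0)"
  have sub: "chi \<in> fuzzy_subsets R"
    by (simp add: chi_def fuzzy_subsets_def)
  have cuts: "cut R chi t = I" if "t \<in> {0..<1}" for t
    using that I by (auto simp: cut_def chi_def hyperideal_def split: if_splits)
  have "fuzzy_hyperideal R chi"
    using sub cuts I by (simp add: fuzzy_hyperideal_iff_cut)
  then have "cut R (fuzzy_inter R chi chi) 0 = cut R (fuzzy_prod R chi chi) 0"
    using assms by simp
  then show "hyperideal_prod R I I = I"
    using cuts[of 0] by (simp add: cut_fuzzy_inter cut_fuzzy_prod sub semihyperring_axioms)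
qed

lemma distributive_lattice_FI:
  assumes "fully_idempotent R"
  shows "distributive_lattice (FI R)"
proof -
  interpret lattice "FI R"
    by (rule lattice_FI)
  show ?thesis
  proof
    fix l m n assume carr: "l \<in> carrier (FI R)" "m \<in> carrier (FI R)" "n \<in> carrier (FI R)"
    then have "fuzzy_inter R l (fuzzy_sum R m n)
        = fuzzy_sum R (fuzzy_inter R l m) (fuzzy_inter R l n)"
      using fully_idempotent_fuzzy_distrib[OF assms] by (simp add: FI_def)
    moreover have "fuzzy_sum R m n \<in> carrier (FI R)" "fuzzy_inter R l m \<in> carrier (FI R)"
      "fuzzy_inter R l n \<in> carrier (FI R)"
      using carr fuzzy_hyperideal_sum fuzzy_hyperideal_inter by (simp_all add: FI_def)
    ultimately show "l \<sqinter>\<^bsub>FI R\<^esub> (m \<squnion>\<^bsub>FI R\<^esub> n) = (l \<sqinter>\<^bsub>FI R\<^esub> m) \<squnion>\<^bsub>FI R\<^esub> (l \<sqinter>\<^bsub>FI R\<^esub> n)"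
      using carr by (simp add: join_FI meet_FI)
  qed
qed

end

section \<open>The equivalence\<close>

theorem theorem3p3:
  fixes R :: "('a, 'c) semihyperring_scheme"
  assumes "semihyperring R"
  shows "fully_idempotent R \<longleftrightarrow>
    (distributive_lattice (FI R) \<and>
     (\<forall>l\<in>carrier (FI R). \<forall>m\<in>carrier (FI R).
        l \<squnion>\<^bsub>FI R\<^esub> m = fuzzy_sum R l m \<and> l \<sqinter>\<^bsub>FI R\<^esub> m = fuzzy_inter R l m) \<and>
     (\<forall>l\<in>carrier (FI R). \<forall>m\<in>carrier (FI R). fuzzy_inter R l m = fuzzy_prod R l m))"
proof -
  interpret semihyperring R
    by (rule assms)
  have FI: "m \<in> carrier (FI R) \<longleftrightarrow> fuzzy_hyperideal R m" for m
    by (simp add: FI_def)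
  show ?thesis
  proof (intro iffI conjI ballI)
    assume "fully_idempotent R"
    then show "distributive_lattice (FI R)"
      by (rule distributive_lattice_FI)
    fix l m assume "l \<in> carrier (FI R)" "m \<in> carrier (FI R)"
    then show "l \<squnion>\<^bsub>FI R\<^esub> m = fuzzy_sum R l m" "l \<sqinter>\<^bsub>FI R\<^esub> m = fuzzy_inter R l m"
      "fuzzy_inter R l m = fuzzy_prod R l m"
      using \<open>fully_idempotent R\<close>
      by (simp_all add: join_FI meet_FI FI fully_idempotent_fuzzy_inter_eq_prod)
  qed (rule fully_idempotent_if_fuzzy_inter_eq_prod, simp add: FI)
qed

end
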